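(* Let $Y$ be a random vector in $\mathbb{R}^d$, $A\in\mathbb{R}^{d\times d}$ invertible, and $\varepsilon=AY$ with $\mathbb{E}\varepsilon=0$ and $\mathrm{var}(\varepsilon)=I_d$. Suppose that for some even $r$ (with $\mathbb{E}\|\varepsilon\|^r<\infty$) the tensor $T=h_r(\varepsilon)$ is reflectionally invariant and, with $l=(r-2)/2$, satisfies $$\sum_{i_1,\dots,i_l=1}^d T_{i_1i_1\cdots i_li_ljj}\neq\sum_{i_1,\dots,i_l=1}^d T_{i_1i_1\cdots i_li_lkk}\qquad\text{for all }j\neq k.$$ Then $A$ is identifiable up to permuting and swapping signs of its rows, i.e. $$\{B\in\mathbb{R}^{d\times d}\text{ invertible}:\mathrm{var}(BY)=I_d,\ h_r(BY)\text{ is reflectionally invariant}\}=\{QA:Q\in\mathrm{SP}(d)\}.$$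
   Context: For a random vector $X$ in $\mathbb{R}^d$ with finite $r$-th moments, $h_r(X)$ denotes (one fixed choice throughout of) either the moment tensor $\mu_r(X)_{i_1\cdots i_r}=\mathbb{E}[X_{i_1}\cdots X_{i_r}]$ or the cumulant tensor $\kappa_r(X)_{i_1\cdots i_r}=\mathrm{cum}(X_{i_1},\dots,X_{i_r})=\sum_{\pi}(-1)^{|\pi|-1}(|\pi|-1)!\prod_{B\in\pi}\mathbb{E}\prod_{k\in B}X_{i_k}$ (sum over set partitions $\pi$ of $\{1,\dots,r\}$). The theorem holds for either choice. A symmetric order-$r$ tensor $T$ is reflectionally invariant if $T_{i_1\cdots i_r}=0$ unless each index value appears in $(i_1,\dots,i_r)$ an even number of times. $\mathrm{SP}(d)$ is the set of $d\times d$ signed permutation matrices, i.e. matrices $DP$ with $D$ diagonal with $\pm1$ diagonal entries and $P$ a permutation matrix. *)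

theory Defs
  imports "HOL-Probability.Probability"
begin

text \<open>
  An order-\<open>r\<close> tensor on \<open>\<real>\<^sup>d\<close> is a function from index tuples to reals.  Index tuples are
  lists \<open>xs\<close> of length \<open>r\<close> over the finite index type \<open>'n\<close> (so \<open>d = CARD('n)\<close>), and tuple
  positions run over \<open>{..<r}\<close> instead of \<open>{1..r}\<close>.  Values on lists of any other length are
  irrelevant.
\<close>

type_synonym 'n tensor = "'n list \<Rightarrow> real"

definition moment_tensor :: "'a measure \<Rightarrow> nat \<Rightarrow> ('a \<Rightarrow> real ^ 'n) \<Rightarrow> 'n tensor" where
  "moment_tensor M r X xs = (\<integral>\<omega>. (\<Prod>k<r. X \<omega> $ (xs ! k)) \<partial>M)"

definition joint_cumulant :: "'a measure \<Rightarrow> nat \<Rightarrow> (nat \<Rightarrow> 'a \<Rightarrow> real) \<Rightarrow> real" where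
  "joint_cumulant M r Z =
     (\<Sum>\<pi> | partition_on {..<r} \<pi>.
        (-1) ^ (card \<pi> - 1) * fact (card \<pi> - 1) * (\<Prod>B\<in>\<pi>. \<integral>\<omega>. (\<Prod>k\<in>B. Z k \<omega>) \<partial>M))"

definition cumulant_tensor :: "'a measure \<Rightarrow> nat \<Rightarrow> ('a \<Rightarrow> real ^ 'n) \<Rightarrow> 'n tensor" where
  "cumulant_tensor M r X xs = joint_cumulant M r (\<lambda>k \<omega>. X \<omega> $ (xs ! k))"

text \<open>Symmetry of \<open>T\<close> is not part of this predicate: it is only applied to moment and cumulant
  tensors, which are symmetric by construction.\<close>

definition reflectionally_invariant :: "nat \<Rightarrow> 'n tensor \<Rightarrow> bool" where
  "reflectionally_invariant r T \<longleftrightarrow>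
     (\<forall>xs. length xs = r \<longrightarrow> \<not> (\<forall>i. even (count_list xs i)) \<longrightarrow> T xs = 0)"

text \<open>The sum over \<open>i\<^sub>1, \<dots>, i\<^sub>l\<close> of the entries of \<open>T\<close> at \<open>(i\<^sub>1, i\<^sub>1, \<dots>, i\<^sub>l, i\<^sub>l, j, j)\<close>.\<close>

definition paired_contraction :: "nat \<Rightarrow> ('n::finite) tensor \<Rightarrow> 'n \<Rightarrow> real" where
  "paired_contraction l T j =
     (\<Sum>xs | length xs = l. T (concat (map (\<lambda>i. [i, i]) xs) @ [j, j]))"

definition covariance_matrix :: "'a measure \<Rightarrow> ('a \<Rightarrow> real ^ 'n) \<Rightarrow> real ^ 'n ^ 'n" where
  "covariance_matrix M X =
     (\<chi> i j. \<integral>\<omega>. (X \<omega> $ i - (\<integral>\<omega>'. X \<omega>' $ i \<partial>M)) * (X \<omega> $ j - (\<integral>\<omega>'. X \<omega>' $ j \<partial>M)) \<partial>M)"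

definition sign_matrix :: "real ^ 'n ^ 'n \<Rightarrow> bool" where
  "sign_matrix D \<longleftrightarrow> (\<forall>i j. i \<noteq> j \<longrightarrow> D $ i $ j = 0) \<and> (\<forall>i. D $ i $ i = 1 \<or> D $ i $ i = -1)"

definition permutation_matrix :: "real ^ 'n ^ 'n \<Rightarrow> bool" where
  "permutation_matrix P \<longleftrightarrow>
     (\<exists>p. p permutes UNIV \<and> P = (\<chi> i j. if j = p i then 1 else 0))"

definition signed_permutation_matrices :: "(real ^ 'n ^ 'n::finite) set" where
  "signed_permutation_matrices = {D ** P | D P. sign_matrix D \<and> permutation_matrix P}"

end

theory Submission
  imports Defs
begin

text \<open>
  Write \<open>B Y = Q \<epsilon>\<close> with \<open>Q = B A\<inverse>\<close>.  The covariance condition makes \<open>Q\<close> orthogonal, and multilinearity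
  of moments and cumulants shows that \<open>h\<^sub>r(Q \<epsilon>)\<close> is the image of \<open>T\<close> under the action of \<open>Q\<close> on
  tensors.  Contracting paired indices commutes with the action of an orthogonal matrix, so the
  contracted \<open>d \<times> d\<close> matrices satisfy \<open>S(Q \<epsilon>) = Q S(\<epsilon>) Q\<^sup>T\<close>.  Reflectional invariance makes both
  diagonal, and since the diagonal entries of \<open>S(\<epsilon>)\<close> are distinct, every row of \<open>Q\<close> has a single
  nonzero entry.
\<close>

section \<open>The action of matrices on tensors\<close>

text \<open>Unfolded, the entry at (x1,...,xr) is the sum over all (y1,...,yr) of Q x1 y1 ... Q xr
  yr T(y1,...,yr). Recursion on the index list lets inductions treat one slot at a time.\<close>

fun transform :: "real ^ 'n ^ 'n \<Rightarrow> ('n::finite) tensor \<Rightarrow> 'n tensor" where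
  "transform Q T [] = T []"
| "transform Q T (x # xs) = (\<Sum>y\<in>UNIV. Q $ x $ y * transform Q (\<lambda>ys. T (y # ys)) xs)"

text \<open>The free indices \<open>zs\<close> are arbitrary, unlike the fixed \<open>[j, j]\<close>
  of \<open>paired_contraction\<close>. This gives access to off-diagonal entries
  \<open>[j, k]\<close> and makes the notion composable with \<open>transform\<close>.\<close>

definition contraction :: "nat \<Rightarrow> ('n::finite) tensor \<Rightarrow> 'n tensor" where
  "contraction l T zs = (\<Sum>xs | length xs = l. T (concat (map (\<lambda>i. [i, i]) xs) @ zs))"

lemma paired_contraction_eq: "paired_contraction l T j = contraction l T [j, j]"
  by (simp add: paired_contraction_def contraction_def)

lemma sum_lists_Suc:
  fixes f :: "('n::finite) list \<Rightarrow> real"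
  shows "(\<Sum>xs | length xs = Suc n. f xs) = (\<Sum>x\<in>UNIV. \<Sum>xs | length xs = n. f (x # xs))"
proof -
  have "{xs :: 'n list. length xs = Suc n} = (\<lambda>(x, xs). x # xs) ` (UNIV \<times> {xs. length xs = n})"
    by (auto simp: length_Suc_conv image_iff)
  moreover have "inj_on (\<lambda>(x, xs). x # xs) (UNIV \<times> {xs :: 'n list. length xs = n})"
    by (auto simp: inj_on_def)
  ultimately show ?thesis
    by (simp add: sum.reindex sum.cartesian_product case_prod_unfold o_def)
qed

lemma contraction_0: "contraction 0 T zs = T zs"
  by (simp add: contraction_def)

lemma contraction_Suc:
  "contraction (Suc l) T zs = (\<Sum>x\<in>UNIV. contraction l (\<lambda>ys. T (x # x # ys)) zs)"
  by (simp add: contraction_def sum_lists_Suc)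

lemma contraction_sum:
  "contraction l (\<lambda>ys. \<Sum>a\<in>S. c a * T a ys) zs = (\<Sum>a\<in>S. c a * contraction l (T a) zs)"
  unfolding contraction_def by (subst sum.swap) (simp add: sum_distrib_left)

lemma transform_sum:
  "transform Q (\<lambda>ys. \<Sum>a\<in>S. T a ys) zs = (\<Sum>a\<in>S. transform Q (T a) zs)"
proof (induction zs arbitrary: T)
  case (Cons z zs)
  have "(\<Sum>y\<in>UNIV. Q $ z $ y * (\<Sum>a\<in>S. transform Q (\<lambda>ys. T a (y # ys)) zs))
      = (\<Sum>a\<in>S. \<Sum>y\<in>UNIV. Q $ z $ y * transform Q (\<lambda>ys. T a (y # ys)) zs)"
    by (subst sum.swap) (simp add: sum_distrib_left)
  then show ?case by (simp add: Cons.IH)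
qed simp

text \<open>Each contracted pair contributes the factor sum over x of Q x y * Q x z, which is the
  (y,z) entry of Q^T Q = I. The pair therefore collapses to the same pair in \<open>T\<close>, and
  induction on \<open>l\<close> removes the pairs one by one.\<close>

lemma contraction_transform:
  fixes Q :: "real ^ 'n ^ 'n"
  assumes "orthogonal_matrix Q"
  shows "contraction l (transform Q T) zs = transform Q (contraction l T) zs"
proof (induction l arbitrary: T)
  case 0
  have "contraction 0 S = S" for S :: "'n tensor" by (rule ext) (rule contraction_0)
  then show ?case by simp
next
  case (Suc l)
  have orth: "(\<Sum>x\<in>UNIV. Q $ x $ y * Q $ x $ z) = (if y = z then 1 else 0)" for y z
  proof -
    have "(transpose Q ** Q) $ y $ z = (mat 1 :: real ^ 'n ^ 'n) $ y $ z"
      using assms by (simp add: orthogonal_matrix_def)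
    then show ?thesis by (simp add: matrix_matrix_mult_def transpose_def mat_def)
  qed
  \<comment> \<open>\<open>?C y z\<close> freezes the first two slots of \<open>T\<close> at
    \<open>y\<close>, \<open>z\<close> and treats only the remaining ones.\<close>
  let ?C = "\<lambda>y z. contraction l (transform Q (\<lambda>ws. T (y # z # ws))) zs"
  have "contraction (Suc l) (transform Q T) zs
      = (\<Sum>x\<in>UNIV. \<Sum>y\<in>UNIV. \<Sum>z\<in>UNIV. Q $ x $ y * Q $ x $ z * ?C y z)"
    by (simp add: contraction_Suc contraction_sum) (simp add: sum_distrib_left mult.assoc)
  also have "\<dots> = (\<Sum>y\<in>UNIV. \<Sum>x\<in>UNIV. \<Sum>z\<in>UNIV. Q $ x $ y * Q $ x $ z * ?C y z)"
    by (rule sum.swap)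
  also have "\<dots> = (\<Sum>y\<in>UNIV. \<Sum>z\<in>UNIV. \<Sum>x\<in>UNIV. Q $ x $ y * Q $ x $ z * ?C y z)"
    by (rule sum.cong[OF refl], rule sum.swap)
  also have "\<dots> = (\<Sum>y\<in>UNIV. \<Sum>z\<in>UNIV. (if y = z then 1 else 0) * ?C y z)"
    by (simp flip: sum_distrib_right add: orth)
  also have "\<dots> = (\<Sum>y\<in>UNIV. ?C y y)"
    by (simp add: if_distrib[of "\<lambda>a. a * _"] cong: if_cong)
  \<comment> \<open>The induction hypothesis is applied to the tensors
    \<open>\<lambda>ys. T (y # y # ys)\<close>, and \<open>transform_sum\<close> moves the sum over
    \<open>y\<close> inside.\<close>
  also have "\<dots> = transform Q (contraction (Suc l) T) zs"
  proof -
    have "contraction (Suc l) T = (\<lambda>zs. \<Sum>y\<in>UNIV. contraction l (\<lambda>ys. T (y # y # ys)) zs)"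
      by (rule ext) (rule contraction_Suc)
    then show ?thesis by (simp add: transform_sum Suc.IH)
  qed
  finally show ?case .
qed

lemma count_list_concat_pairs: "even (count_list (concat (map (\<lambda>i. [i, i]) xs)) a)"
  by (induction xs) auto

text \<open>The paired indices contribute even multiplicities, so for \<open>j \<noteq> k\<close>
  the value \<open>j\<close> occurs an odd number of times in every summand.\<close>

lemma contraction_off_diagonal:
  assumes "reflectionally_invariant (2 * l + 2) T" "j \<noteq> k"
  shows "contraction l T [j, k] = 0"
  unfolding contraction_def
proof (intro sum.neutral ballI)
  fix xs :: "'a list" assume "xs \<in> {xs. length xs = l}"
  then have "length (concat (map (\<lambda>i. [i, i]) xs) @ [j, k]) = 2 * l + 2"
    by (simp add: length_concat o_def sum_list_triv)
  moreover have "odd (count_list (concat (map (\<lambda>i. [i, i]) xs) @ [j, k]) j)"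
    using assms(2) count_list_concat_pairs[of xs j] by simp
  ultimately show "T (concat (map (\<lambda>i. [i, i]) xs) @ [j, k]) = 0"
    using assms(1) unfolding reflectionally_invariant_def by blast
qed

section \<open>Signed permutation matrices\<close>

text \<open>Entrywise form of the product D P: row \<open>x\<close> has its only nonzero entry, the
  sign \<open>s x\<close>, in column \<open>p x\<close>. Later arguments work with \<open>p\<close>
  and \<open>s\<close> instead of the factorization.\<close>

lemma signed_permutation_matrix_iff:
  fixes Q :: "real ^ 'n ^ 'n"
  shows "Q \<in> signed_permutation_matrices \<longleftrightarrow>
    (\<exists>p s. p permutes UNIV \<and> (\<forall>x. s x = 1 \<or> s x = -1) \<and> (\<forall>x y. Q $ x $ y = (if y = p x then s x else 0)))"
proof
  assume "Q \<in> signed_permutation_matrices"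
  then obtain D P where "Q = D ** P" "sign_matrix D" "permutation_matrix P"
    unfolding signed_permutation_matrices_def by blast
  then obtain p where p: "p permutes UNIV" "Q = D ** (\<chi> i j. if j = p i then 1 else 0)"
    unfolding permutation_matrix_def by blast
  have D0: "D $ x $ y = 0" if "x \<noteq> y" for x y
    using that \<open>sign_matrix D\<close> by (auto simp: sign_matrix_def)
  have "Q $ x $ y = (if y = p x then D $ x $ x else 0)" for x y
  proof -
    have "Q $ x $ y = (\<Sum>k\<in>UNIV. D $ x $ k * (if y = p k then 1 else 0))"
      by (simp add: p(2) matrix_matrix_mult_def)
    also have "\<dots> = (\<Sum>k\<in>UNIV. if k = x then D $ x $ x * (if y = p x then 1 else 0) else 0)"
      using D0 by (intro sum.cong) auto
    finally show ?thesis by simp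
  qed
  moreover have "\<forall>x. D $ x $ x = 1 \<or> D $ x $ x = -1"
    using \<open>sign_matrix D\<close> by (simp add: sign_matrix_def)
  ultimately show "\<exists>p s. p permutes UNIV \<and> (\<forall>x. s x = 1 \<or> s x = -1) \<and>
      (\<forall>x y. Q $ x $ y = (if y = p x then s x else 0))"
    using p(1) by (intro exI[of _ p] exI[of _ "\<lambda>x. D $ x $ x"] conjI allI) simp_all
next
  assume "\<exists>p s. p permutes UNIV \<and> (\<forall>x. s x = 1 \<or> s x = -1) \<and>
      (\<forall>x y. Q $ x $ y = (if y = p x then s x else 0))"
  then obtain p s where p: "p permutes UNIV" and s: "\<forall>x. s x = 1 \<or> s x = -1"
    and Q: "\<forall>x y. Q $ x $ y = (if y = p x then s x else 0)" by blast
  define D :: "real ^ 'n ^ 'n" where "D = (\<chi> i j. if i = j then s i else 0)"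
  define P :: "real ^ 'n ^ 'n" where "P = (\<chi> i j. if j = p i then 1 else 0)"
  have "Q = D ** P"
    by (simp add: vec_eq_iff Q D_def P_def matrix_matrix_mult_def if_distrib[of "\<lambda>a. a * _"] cong: if_cong)
  moreover have "sign_matrix D" using s by (simp add: sign_matrix_def D_def)
  moreover have "permutation_matrix P" using p by (auto simp: permutation_matrix_def P_def)
  ultimately show "Q \<in> signed_permutation_matrices"
    unfolding signed_permutation_matrices_def by blast
qed

lemma matrix_mult_transpose_nth:
  fixes Q :: "real ^ 'n ^ 'm"
  shows "(Q ** transpose Q) $ i $ j = (\<Sum>k\<in>UNIV. Q $ i $ k * Q $ j $ k)"
  by (simp add: matrix_matrix_mult_def transpose_def)

lemma signed_permutation_matrix_orthogonal:
  fixes Q :: "real ^ 'n ^ 'n"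
  assumes "Q \<in> signed_permutation_matrices"
  shows "Q ** transpose Q = mat 1"
proof -
  obtain p s where p: "p permutes UNIV" and s: "\<forall>x. s x = 1 \<or> s x = -1"
    and Q: "\<forall>x y. Q $ x $ y = (if y = p x then s x else 0)"
    using assms unfolding signed_permutation_matrix_iff by blast
  have "inj p" using p by (rule permutes_inj)
  have "(\<Sum>k\<in>UNIV. Q $ i $ k * Q $ j $ k) = (if i = j then 1 else 0)" for i j
  proof -
    have "(\<Sum>k\<in>UNIV. Q $ i $ k * Q $ j $ k) = (\<Sum>k\<in>UNIV. if k = p i then s i * Q $ j $ k else 0)"
      by (rule sum.cong) (simp_all add: Q)
    also have "\<dots> = s i * Q $ j $ p i" by simp
    also have "\<dots> = (if i = j then 1 else 0)"
      using s \<open>inj p\<close> by (auto simp: Q inj_eq) (metis minus_mult_minus mult_1)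
    finally show ?thesis .
  qed
  then show ?thesis by (simp add: vec_eq_iff matrix_mult_transpose_nth mat_def)
qed

lemma transform_signed_permutation:
  fixes Q :: "real ^ 'n ^ 'n"
  assumes "\<forall>x y. Q $ x $ y = (if y = p x then s x else 0)"
  shows "transform Q T xs = prod_list (map s xs) * T (map p xs)"
proof (induction xs arbitrary: T)
  case (Cons x xs)
  have "transform Q T (x # xs)
      = (\<Sum>y\<in>UNIV. if y = p x then s x * transform Q (\<lambda>ys. T (y # ys)) xs else 0)"
    unfolding transform.simps by (rule sum.cong) (simp_all add: assms)
  then show ?case by (simp add: Cons.IH)
qed simp

text \<open>A signed permutation relabels the indices by the injection \<open>p\<close> and
  multiplies the entry by signs. Multiplicities of index values are carried along, so their parities
  survive.\<close>

lemma reflectionally_invariant_transform: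
  fixes Q :: "real ^ 'n ^ 'n"
  assumes "Q \<in> signed_permutation_matrices" "reflectionally_invariant r T"
  shows "reflectionally_invariant r (transform Q T)"
proof -
  obtain p s where p: "p permutes UNIV"
    and Q: "\<forall>x y. Q $ x $ y = (if y = p x then s x else 0)"
    using assms(1) unfolding signed_permutation_matrix_iff by blast
  have count: "count_list (map p xs) (p i) = count_list xs i" for xs i
    using permutes_inj[OF p] by (induction xs) (auto simp: inj_eq)
  show ?thesis
    unfolding reflectionally_invariant_def
  proof (intro allI impI)
    fix xs :: "'n list" assume "length xs = r" "\<not> (\<forall>i. even (count_list xs i))"
    then obtain i where "odd (count_list xs i)" by blast
    then have "odd (count_list (map p xs) (p i))" by (simp only: count not_False_eq_True)
    moreover have "length (map p xs) = r" using \<open>length xs = r\<close> by simp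
    ultimately have "T (map p xs) = 0"
      using assms(2) unfolding reflectionally_invariant_def by blast
    then show "transform Q T xs = 0"
      by (simp add: transform_signed_permutation[OF Q])
  qed
qed

text \<open>With D = diag(d), the hypothesis \<open>diag\<close> says that Q D Q^T is diagonal, so
  the rows of \<open>Q\<close> are eigenvectors of D. As the entries of D are distinct, its
  eigenspaces are the coordinate axes.\<close>

lemma diagonalizing_orthogonal_matrix_signed_permutation:
  fixes Q :: "real ^ 'n ^ 'n"
  assumes "orthogonal_matrix Q" and inj: "\<And>i j. i \<noteq> j \<Longrightarrow> d i \<noteq> d j"
    and diag: "\<And>i j. i \<noteq> j \<Longrightarrow> (\<Sum>a\<in>UNIV. Q $ i $ a * Q $ j $ a * d a) = 0"
  shows "Q \<in> signed_permutation_matrices"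
proof -
  have QQt: "(\<Sum>k\<in>UNIV. Q $ i $ k * Q $ j $ k) = (if i = j then 1 else 0)" for i j
  proof -
    have "(Q ** transpose Q) $ i $ j = (mat 1 :: real ^ 'n ^ 'n) $ i $ j"
      using assms(1) by (simp add: orthogonal_matrix_def)
    then show ?thesis by (simp add: matrix_mult_transpose_nth mat_def)
  qed
  have QtQ: "(\<Sum>k\<in>UNIV. Q $ k $ a * Q $ k $ b) = (if a = b then 1 else 0)" for a b
  proof -
    have "(transpose Q ** Q) $ a $ b = (mat 1 :: real ^ 'n ^ 'n) $ a $ b"
      using assms(1) by (simp add: orthogonal_matrix_def)
    then show ?thesis by (simp add: matrix_matrix_mult_def transpose_def mat_def)
  qed
  define e where "e i = (\<Sum>a\<in>UNIV. Q $ i $ a * Q $ i $ a * d a)" for i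
  \<comment> \<open>The (i,b) entry of (Q D Q^T) Q is computed twice: through diagonality of the
    bracket, with diagonal entries \<open>e i\<close>, and through Q^T Q = I.\<close>
  have eig: "Q $ i $ b * d b = e i * Q $ i $ b" for i b
  proof -
    have "(\<Sum>k\<in>UNIV. (\<Sum>a\<in>UNIV. Q $ i $ a * Q $ k $ a * d a) * Q $ k $ b)
        = (\<Sum>k\<in>UNIV. if k = i then e i * Q $ i $ b else 0)"
      by (rule sum.cong) (auto simp: e_def diag)
    also have "\<dots> = e i * Q $ i $ b" by simp
    finally have 1: "(\<Sum>k\<in>UNIV. (\<Sum>a\<in>UNIV. Q $ i $ a * Q $ k $ a * d a) * Q $ k $ b)
        = e i * Q $ i $ b" .
    have "(\<Sum>k\<in>UNIV. (\<Sum>a\<in>UNIV. Q $ i $ a * Q $ k $ a * d a) * Q $ k $ b)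
        = (\<Sum>a\<in>UNIV. \<Sum>k\<in>UNIV. Q $ i $ a * Q $ k $ a * d a * Q $ k $ b)"
      unfolding sum_distrib_right by (rule sum.swap)
    also have "\<dots> = (\<Sum>a\<in>UNIV. Q $ i $ a * d a * (\<Sum>k\<in>UNIV. Q $ k $ a * Q $ k $ b))"
      by (simp add: sum_distrib_left mult_ac)
    also have "\<dots> = Q $ i $ b * d b"
      by (simp add: QtQ if_distrib[of "\<lambda>x. _ * x"] cong: if_cong)
    finally show ?thesis using 1 by (rule trans[OF sym])
  qed
  have "\<exists>a. Q $ i $ a \<noteq> 0" for i
  proof (rule ccontr)
    assume "\<not> ?thesis"
    then show False using QQt[of i i] by simp
  qed
  then obtain p where p: "\<And>i. Q $ i $ p i \<noteq> 0" by metis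
  have d_p: "d (p i) = e i" for i using eig[of i "p i"] p[of i] by simp
  \<comment> \<open>A nonzero entry in column \<open>a\<close> would force
    \<open>d a = e i = d (p i)\<close>, against the distinctness of the values of
    \<open>d\<close>.\<close>
  have zero: "Q $ i $ a = 0" if "a \<noteq> p i" for i a
    using eig[of i a] inj[OF that] d_p[of i] by auto
  have row_sum: "(\<Sum>k\<in>UNIV. Q $ i $ k * Q $ j $ k) = Q $ i $ p i * Q $ j $ p i" for i j
  proof -
    have "(\<Sum>k\<in>UNIV. Q $ i $ k * Q $ j $ k)
        = (\<Sum>k\<in>UNIV. if k = p i then Q $ i $ p i * Q $ j $ p i else 0)"
      by (rule sum.cong) (auto simp: zero)
    then show ?thesis by simp
  qed
  \<comment> \<open>Two rows supported in the same column would have a nonzero inner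
    product.\<close>
  have "inj p"
  proof (rule injI, rule ccontr)
    fix i j assume "p i = p j" "i \<noteq> j"
    then show False using row_sum[of i j] QQt[of i j] p[of i] p[of j] by simp
  qed
  then have "bij p" by (simp add: finite_UNIV_inj_surj bij_def)
  then have "p permutes UNIV" by (intro bij_imp_permutes) auto
  moreover have "Q $ i $ p i = 1 \<or> Q $ i $ p i = -1" for i
    using row_sum[of i i] QQt[of i i] by (simp add: square_eq_1_iff)
  moreover have "Q $ i $ a = (if a = p i then Q $ i $ p i else 0)" for i a
    by (simp add: zero)
  ultimately show ?thesis
    unfolding signed_permutation_matrix_iff by (intro exI[of _ p] exI[of _ "\<lambda>i. Q $ i $ p i"] conjI allI) blast+
qed

section \<open>Multilinearity of moments and cumulants\<close>

definition multilinear_list :: "nat \<Rightarrow> ('v::real_vector list \<Rightarrow> real) \<Rightarrow> bool" where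
  "multilinear_list r F \<longleftrightarrow>
     (\<forall>us vs. Suc (length us + length vs) = r \<longrightarrow> linear (\<lambda>w. F (us @ w # vs)))"

text \<open>Each row of \<open>Q\<close> is expanded in the standard basis, one slot after another.
  The prefix \<open>us\<close> is general so that the induction can store the basis vectors already
  chosen.\<close>

lemma multilinear_list_transform:
  fixes F :: "(real ^ 'n) list \<Rightarrow> real" and Q :: "real ^ 'n ^ 'n"
  assumes "multilinear_list r F" "length us + length xs = r"
  shows "F (us @ map (\<lambda>i. row i Q) xs)
    = transform Q (\<lambda>ys. F (us @ map (\<lambda>i. axis i 1) ys)) xs"
  using assms(2)
proof (induction xs arbitrary: us)
  case (Cons x xs)
  have lin: "linear (\<lambda>w. F (us @ w # map (\<lambda>i. row i Q) xs))"
    using assms(1) Cons.prems by (simp add: multilinear_list_def)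
  have "row x Q = (\<Sum>y\<in>UNIV. Q $ x $ y *\<^sub>R axis y 1)"
    by (simp add: vec_eq_iff row_def axis_def if_distrib[of "\<lambda>a. _ * a"] cong: if_cong)
  then have "F (us @ map (\<lambda>i. row i Q) (x # xs))
      = (\<Sum>y\<in>UNIV. Q $ x $ y * F ((us @ [axis y 1]) @ map (\<lambda>i. row i Q) xs))"
    by (simp add: linear_sum[OF lin] linear_scale[OF lin])
  also have "\<dots> = transform Q (\<lambda>ys. F (us @ map (\<lambda>i. axis i 1) ys)) (x # xs)"
    by (subst Cons.IH) (use Cons.prems in simp_all)
  finally show ?case .
qed simp

definition moment_form :: "'a measure \<Rightarrow> nat \<Rightarrow> ('a \<Rightarrow> 'v::real_inner) \<Rightarrow> 'v list \<Rightarrow> real" where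
  "moment_form M r X vs = (\<integral>\<omega>. (\<Prod>k<r. vs ! k \<bullet> X \<omega>) \<partial>M)"

definition cumulant_form :: "'a measure \<Rightarrow> nat \<Rightarrow> ('a \<Rightarrow> 'v::real_inner) \<Rightarrow> 'v list \<Rightarrow> real" where
  "cumulant_form M r X vs = joint_cumulant M r (\<lambda>k \<omega>. vs ! k \<bullet> X \<omega>)"

lemma moment_tensor_matrix_vector:
  fixes Q :: "real ^ 'n ^ 'm"
  assumes "length xs = r"
  shows "moment_tensor M r (\<lambda>\<omega>. Q *v X \<omega>) xs = moment_form M r X (map (\<lambda>i. row i Q) xs)"
  using assms by (simp add: moment_tensor_def moment_form_def matrix_vector_mul_component row_def)

lemma cumulant_tensor_matrix_vector:
  fixes Q :: "real ^ 'n ^ 'm"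
  assumes "length xs = r"
  shows "cumulant_tensor M r (\<lambda>\<omega>. Q *v X \<omega>) xs = cumulant_form M r X (map (\<lambda>i. row i Q) xs)"
  unfolding cumulant_tensor_def cumulant_form_def joint_cumulant_def
proof (intro sum.cong refl arg_cong2[of _ _ _ _ "(*)"] prod.cong Bochner_Integration.integral_cong)
  fix \<pi> B k \<omega> assume "\<pi> \<in> {\<pi>. partition_on {..<r} \<pi>}" "B \<in> \<pi>" "k \<in> B"
  then have "k < length xs" using assms by (auto simp: partition_on_def)
  then show "(Q *v X \<omega>) $ (xs ! k) = map (\<lambda>i. row i Q) xs ! k \<bullet> X \<omega>"
    by (simp add: matrix_vector_mul_component row_def)
qed

section \<open>Expectations of products: integrability, multilinearity and covariance\<close>

context prob_space
begin

text \<open>Cauchy-Schwarz bounds the product by a constant times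
  \<open>norm (X \<omega>) ^ card B\<close>, which is at most
  \<open>1 + norm (X \<omega>) ^ r\<close>; the constant 1 is integrable under a probability
  measure. Sets with fewer than \<open>r\<close> elements cover the lower moments inside
  cumulants.\<close>

lemma integrable_prod_inner:
  fixes X :: "'a \<Rightarrow> 'v::euclidean_space"
  assumes "X \<in> borel_measurable M" "integrable M (\<lambda>\<omega>. norm (X \<omega>) ^ r)" "finite B" "card B \<le> r"
  shows "integrable M (\<lambda>\<omega>. \<Prod>k\<in>B. v k \<bullet> X \<omega>)"
proof (rule Bochner_Integration.integrable_bound)
  show "integrable M (\<lambda>\<omega>. (\<Prod>k\<in>B. norm (v k)) * (1 + norm (X \<omega>) ^ r))"
    using assms(2) by simp
  show "(\<lambda>\<omega>. \<Prod>k\<in>B. v k \<bullet> X \<omega>) \<in> borel_measurable M"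
    using assms(1) by measurable
  show "AE \<omega> in M. norm (\<Prod>k\<in>B. v k \<bullet> X \<omega>) \<le> norm ((\<Prod>k\<in>B. norm (v k)) * (1 + norm (X \<omega>) ^ r))"
  proof (rule AE_I2)
    fix \<omega>
    have pow: "norm (X \<omega>) ^ card B \<le> 1 + norm (X \<omega>) ^ r"
    proof (cases "norm (X \<omega>) \<le> 1")
      case True
      then have "norm (X \<omega>) ^ card B \<le> 1" by (simp add: power_le_one)
      then show ?thesis by (simp add: add_increasing2)
    next
      case False
      then have "norm (X \<omega>) ^ card B \<le> norm (X \<omega>) ^ r"
        using assms(4) by (intro power_increasing) auto
      then show ?thesis by simp
    qed
    have "norm (\<Prod>k\<in>B. v k \<bullet> X \<omega>) = (\<Prod>k\<in>B. \<bar>v k \<bullet> X \<omega>\<bar>)"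
      by (simp add: abs_prod)
    also have "\<dots> \<le> (\<Prod>k\<in>B. norm (v k) * norm (X \<omega>))"
      by (intro prod_mono) (simp add: Cauchy_Schwarz_ineq2)
    also have "\<dots> = (\<Prod>k\<in>B. norm (v k)) * norm (X \<omega>) ^ card B"
      by (simp add: prod.distrib)
    also have "\<dots> \<le> (\<Prod>k\<in>B. norm (v k)) * (1 + norm (X \<omega>) ^ r)"
      by (intro mult_left_mono pow prod_nonneg) simp
    also have "\<dots> \<le> norm ((\<Prod>k\<in>B. norm (v k)) * (1 + norm (X \<omega>) ^ r))" by simp
    finally show "norm (\<Prod>k\<in>B. v k \<bullet> X \<omega>) \<le> norm ((\<Prod>k\<in>B. norm (v k)) * (1 + norm (X \<omega>) ^ r))" .
  qed
qed

lemma linear_expectation_prod_inner: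
  fixes X :: "'a \<Rightarrow> 'v::euclidean_space"
  assumes "X \<in> borel_measurable M" "integrable M (\<lambda>\<omega>. norm (X \<omega>) ^ r)" "finite B" "card B \<le> r"
    and "length us \<in> B"
  shows "linear (\<lambda>w. \<integral>\<omega>. (\<Prod>k\<in>B. (us @ w # vs) ! k \<bullet> X \<omega>) \<partial>M)"
proof -
  \<comment> \<open>\<open>P\<close> collects the factors that do not involve \<open>w\<close>. The
    vector 0 is only a placeholder, since its slot is excluded from the product.\<close>
  define P where "P \<omega> = (\<Prod>k\<in>B - {length us}. (us @ 0 # vs) ! k \<bullet> X \<omega>)" for \<omega>
  have eq: "(\<Prod>k\<in>B. (us @ w # vs) ! k \<bullet> X \<omega>) = w \<bullet> X \<omega> * P \<omega>" for w \<omega>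
  proof -
    have "(us @ w # vs) ! k = (us @ 0 # vs) ! k" if "k \<noteq> length us" for k
      using that by (simp add: nth_append nth_Cons')
    then have "(\<Prod>k\<in>B - {length us}. (us @ w # vs) ! k \<bullet> X \<omega>) = P \<omega>"
      unfolding P_def by (intro prod.cong refl) simp
    then show ?thesis by (simp add: prod.remove[OF assms(3,5)])
  qed
  have int: "integrable M (\<lambda>\<omega>. w \<bullet> X \<omega> * P \<omega>)" for w
    using integrable_prod_inner[OF assms(1-4), of "\<lambda>k. (us @ w # vs) ! k"] by (simp add: eq)
  show ?thesis
    unfolding eq
    by (rule linearI)
      (use int in \<open>simp_all add: inner_add_left distrib_right mult.assoc\<close>)
qed

lemma multilinear_list_moment_form:
  fixes X :: "'a \<Rightarrow> 'v::euclidean_space"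
  assumes "X \<in> borel_measurable M" "integrable M (\<lambda>\<omega>. norm (X \<omega>) ^ r)"
  shows "multilinear_list r (moment_form M r X)"
  unfolding multilinear_list_def moment_form_def
  by (intro allI impI linear_expectation_prod_inner[OF assms]) auto

text \<open>In each set partition exactly one block contains the varied position. Its expectation is
  linear in \<open>w\<close>, the other blocks give constants, and a sum of linear maps is
  linear.\<close>

lemma multilinear_list_cumulant_form:
  fixes X :: "'a \<Rightarrow> 'v::euclidean_space"
  assumes "X \<in> borel_measurable M" "integrable M (\<lambda>\<omega>. norm (X \<omega>) ^ r)"
  shows "multilinear_list r (cumulant_form M r X)"
  unfolding multilinear_list_def cumulant_form_def joint_cumulant_def
proof (intro allI impI linear_compose_sum ballI)
  fix us vs :: "'v list" and \<pi>
  assume len: "Suc (length us + length vs) = r" and "\<pi> \<in> {\<pi>. partition_on {..<r} \<pi>}"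
  then have part: "partition_on {..<r} \<pi>" by simp
  define E where "E w B = (\<integral>\<omega>. (\<Prod>k\<in>B. (us @ w # vs) ! k \<bullet> X \<omega>) \<partial>M)" for w B
  have "length us \<in> \<Union>\<pi>" using part len by (auto simp: partition_on_def)
  then obtain B where B: "B \<in> \<pi>" "length us \<in> B" by blast
  have "finite \<pi>" using part finite_elements by blast
  have "B \<subseteq> {..<r}" using part B by (auto simp: partition_on_def)
  then have finB: "finite B" and cardB: "card B \<le> r"
    using finite_subset card_mono[of "{..<r}" B] by auto
  have others: "E w C = E 0 C" if "C \<in> \<pi> - {B}" for w C
  proof -
    have "length us \<notin> C" using that B part by (auto simp: partition_on_def disjoint_def)
    then show ?thesis
      unfolding E_def
      by (auto simp: nth_append nth_Cons' intro!: Bochner_Integration.integral_cong prod.cong)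
  qed
  have prod_eq: "(\<Prod>C\<in>\<pi>. E w C) = (\<Prod>C\<in>\<pi> - {B}. E 0 C) * E w B" for w
  proof -
    have "(\<Prod>C\<in>\<pi> - {B}. E w C) = (\<Prod>C\<in>\<pi> - {B}. E 0 C)"
      by (intro prod.cong refl others)
    then show ?thesis by (simp add: prod.remove[OF \<open>finite \<pi>\<close> B(1)])
  qed
  have "linear (\<lambda>w. E w B)"
    unfolding E_def by (rule linear_expectation_prod_inner[OF assms finB cardB B(2)])
  then have "linear (\<lambda>w. (c * (\<Prod>C\<in>\<pi> - {B}. E 0 C)) *\<^sub>R E w B)" for c
    by (intro linear_compose_scale_right)
  then have "linear (\<lambda>w. c * (\<Prod>C\<in>\<pi>. E w C))" for c
    by (simp add: prod_eq mult.assoc)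
  then show "linear (\<lambda>w. (-1) ^ (card \<pi> - 1) * fact (card \<pi> - 1) *
      (\<Prod>B\<in>\<pi>. \<integral>\<omega>. (\<Prod>k\<in>B. (us @ w # vs) ! k \<bullet> X \<omega>) \<partial>M))"
    unfolding E_def .
qed

text \<open>Since (Q X)_i is the inner product of row i of \<open>Q\<close> with \<open>X\<close>,
  the tensors of all Q X are values of a single multilinear form \<open>F\<close>, taken at rows of
  \<open>Q\<close>.\<close>

lemma moment_or_cumulant_transform:
  fixes X :: "'a \<Rightarrow> real ^ 'n" and Q :: "real ^ 'n ^ 'n"
  assumes "X \<in> borel_measurable M" "integrable M (\<lambda>\<omega>. norm (X \<omega>) ^ r)"
    and "h = moment_tensor M \<or> h = cumulant_tensor M" and "length xs = r"
  shows "h r (\<lambda>\<omega>. Q *v X \<omega>) xs = transform Q (h r X) xs"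
proof -
  obtain F where F: "multilinear_list r F"
    and h: "\<And>(Q :: real ^ 'n ^ 'n) xs. length xs = r \<Longrightarrow> h r (\<lambda>\<omega>. Q *v X \<omega>) xs = F (map (\<lambda>i. row i Q) xs)"
    using assms(3) multilinear_list_moment_form[OF assms(1,2)] multilinear_list_cumulant_form[OF assms(1,2)]
      moment_tensor_matrix_vector cumulant_tensor_matrix_vector by metis
  \<comment> \<open>\<open>transform\<close> reads a tensor only at lists as long as its argument;
    \<open>F\<close> and \<open>h\<close> are related only at length \<open>r\<close>.\<close>
  have cong: "transform Q S zs = transform Q S' zs"
    if "\<And>ys. length ys = length zs \<Longrightarrow> S ys = S' ys" for S S' :: "'n tensor" and zs
    using that
  proof (induction zs arbitrary: S S')
    case (Cons z zs)
    have "transform Q (\<lambda>ys. S (y # ys)) zs = transform Q (\<lambda>ys. S' (y # ys)) zs" for y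
      by (rule Cons.IH) (simp add: Cons.prems)
    then show ?case by simp
  qed simp
  have row1: "row i (mat 1) = (axis i 1 :: real ^ 'n)" for i
    by (simp add: vec_eq_iff row_def axis_def mat_def)
  have "h r (\<lambda>\<omega>. Q *v X \<omega>) xs = transform Q (\<lambda>ys. F (map (\<lambda>i. axis i 1) ys)) xs"
    using multilinear_list_transform[OF F, of "[]" xs Q] assms(4) by (simp add: h)
  \<comment> \<open>Taking the identity for the matrix turns rows into basis vectors and identifies
    the values of \<open>F\<close> there as the entries of \<open>h r X\<close>.\<close>
  also have "\<dots> = transform Q (h r X) xs"
    by (rule cong) (use h[of _ "mat 1"] assms(4) in \<open>simp add: row1\<close>)
  finally show ?thesis .
qed

lemma covariance_matrix_matrix_vector:
  fixes X :: "'a \<Rightarrow> real ^ 'n" and Q :: "real ^ 'n ^ 'n"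
  assumes "X \<in> borel_measurable M" "integrable M (\<lambda>\<omega>. norm (X \<omega>) ^ r)" "r \<ge> 2"
    and mean: "(\<integral>\<omega>. X \<omega> \<partial>M) = 0" and cov: "covariance_matrix M X = mat 1"
  shows "covariance_matrix M (\<lambda>\<omega>. Q *v X \<omega>) = Q ** transpose Q"
proof -
  have "integrable M (\<lambda>\<omega>. \<Prod>k\<in>{0::nat}. v \<bullet> X \<omega>)" for v
    by (rule integrable_prod_inner[OF assms(1,2)]) (use assms(3) in auto)
  from this[of "axis i 1" for i] have int1: "integrable M (\<lambda>\<omega>. X \<omega> $ i)" for i
    by (simp add: inner_axis')
  have "integrable M (\<lambda>\<omega>. \<Prod>k\<in>{0::nat, 1}. (if k = 0 then v else w) \<bullet> X \<omega>)" for v w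
    by (rule integrable_prod_inner[OF assms(1,2)]) (use assms(3) in auto)
  from this[of "axis i 1" "axis j 1" for i j]
  have int2: "integrable M (\<lambda>\<omega>. X \<omega> $ i * X \<omega> $ j)" for i j
    by (simp add: inner_axis')
  \<comment> \<open>Vector-valued integrability allows the coordinates of the mean vector to be read
    as the means of the coordinates.\<close>
  have "integrable M X"
  proof -
    have "X \<omega> = (\<Sum>i\<in>UNIV. X \<omega> $ i *\<^sub>R axis i 1)" for \<omega>
      by (simp add: vec_eq_iff axis_def if_distrib[of "\<lambda>a. _ * a"] cong: if_cong)
    then have "X = (\<lambda>\<omega>. \<Sum>i\<in>UNIV. X \<omega> $ i *\<^sub>R axis i 1)" by blast
    then show ?thesis
      by (rule ssubst) (intro Bochner_Integration.integrable_sum integrable_scaleR_left int1)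
  qed
  then have mean0: "(\<integral>\<omega>. X \<omega> $ i \<partial>M) = 0" for i
    using integral_inner_left[of "axis i 1" M X] mean
    by (simp add: cart_eq_inner_axis)
  have cov0: "(\<integral>\<omega>. X \<omega> $ i * X \<omega> $ j \<partial>M) = (if i = j then 1 else 0)" for i j
    using arg_cong[OF cov, of "\<lambda>C. C $ i $ j"] by (simp add: covariance_matrix_def mean0 mat_def)
  have "(\<integral>\<omega>. (Q *v X \<omega>) $ i \<partial>M) = 0" for i
    by (simp add: matrix_vector_mult_def int1 mean0)
  moreover have "(\<integral>\<omega>. (Q *v X \<omega>) $ i * (Q *v X \<omega>) $ j \<partial>M) = (\<Sum>k\<in>UNIV. Q $ i $ k * Q $ j $ k)" for i j
  proof -
    have "(Q *v X \<omega>) $ i * (Q *v X \<omega>) $ j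
        = (\<Sum>a\<in>UNIV. \<Sum>b\<in>UNIV. (Q $ i $ a * Q $ j $ b) * (X \<omega> $ a * X \<omega> $ b))" for \<omega>
      by (simp add: matrix_vector_mult_def sum_product mult_ac)
    then have "(\<integral>\<omega>. (Q *v X \<omega>) $ i * (Q *v X \<omega>) $ j \<partial>M)
        = (\<Sum>a\<in>UNIV. \<Sum>b\<in>UNIV. (Q $ i $ a * Q $ j $ b) * (if a = b then 1 else 0))"
      by (simp add: int2 cov0)
    then show ?thesis by (simp add: if_distrib[of "\<lambda>x. _ * x"] cong: if_cong)
  qed
  ultimately show ?thesis
    by (simp add: vec_eq_iff covariance_matrix_def matrix_mult_transpose_nth)
qed

end

section \<open>Identifiability up to signed permutations\<close>

theorem theorem5p14:
  fixes M :: "'a measure"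
    and Y \<epsilon> :: "'a \<Rightarrow> real ^ 'n"
    and A :: "real ^ 'n ^ 'n"
    and r l :: nat
    and h :: "nat \<Rightarrow> ('a \<Rightarrow> real ^ 'n) \<Rightarrow> 'n tensor"
  assumes "prob_space M"
    and "Y \<in> borel_measurable M"
    and "invertible A"
    and "\<epsilon> = (\<lambda>\<omega>. A *v Y \<omega>)"
    and "(\<integral>\<omega>. \<epsilon> \<omega> \<partial>M) = 0"
    and "covariance_matrix M \<epsilon> = mat 1"
    and "h = moment_tensor M \<or> h = cumulant_tensor M"
    and "even r" and "r \<ge> 2" and "l = (r - 2) div 2"
    and "integrable M (\<lambda>\<omega>. norm (\<epsilon> \<omega>) ^ r)"
    and "reflectionally_invariant r (h r \<epsilon>)"
    and "\<forall>j k. j \<noteq> k \<longrightarrow> paired_contraction l (h r \<epsilon>) j \<noteq> paired_contraction l (h r \<epsilon>) k"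
  shows "{B :: real ^ 'n ^ 'n. invertible B \<and> covariance_matrix M (\<lambda>\<omega>. B *v Y \<omega>) = mat 1
            \<and> reflectionally_invariant r (h r (\<lambda>\<omega>. B *v Y \<omega>))}
         = {Q ** A | Q. Q \<in> signed_permutation_matrices}"
proof -
  interpret prob_space M by fact
  let ?T = "h r \<epsilon>"
  have r: "r = 2 * l + 2" using assms(8-10) by auto
  have meas: "\<epsilon> \<in> borel_measurable M"
    unfolding assms(4)
    by (intro borel_measurable_continuous_on[OF _ assms(2)] linear_continuous_on
        matrix_vector_mul_bounded_linear)
  note tr = moment_or_cumulant_transform[OF meas assms(11,7)]
  note cov = covariance_matrix_matrix_vector[OF meas assms(11,9,5,6)]
  have eps: "(\<lambda>\<omega>. (Q ** A) *v Y \<omega>) = (\<lambda>\<omega>. Q *v \<epsilon> \<omega>)" for Q :: "real ^ 'n ^ 'n"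
    by (simp add: assms(4) matrix_vector_mul_assoc)
  \<comment> \<open>The transformation law \<open>tr\<close> holds at lists of length
    \<open>r\<close>, which are exactly those that reflectional invariance inspects.\<close>
  have inv_T: "reflectionally_invariant r (h r (\<lambda>\<omega>. Q *v \<epsilon> \<omega>)) \<longleftrightarrow>
      reflectionally_invariant r (transform Q ?T)" for Q
    unfolding reflectionally_invariant_def using tr by (metis (no_types, lifting))
  have signed_perm: "Q \<in> signed_permutation_matrices"
    if QQt: "Q ** transpose Q = mat 1" and inv: "reflectionally_invariant r (transform Q ?T)" for Q
  proof -
    let ?d = "\<lambda>a. contraction l ?T [a, a]"
    have orth: "orthogonal_matrix Q"
      using QQt by (simp add: orthogonal_matrix_def matrix_left_right_inverse)
    have diag: "contraction l ?T [a, b] = (if a = b then ?d a else 0)" for a b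
      using contraction_off_diagonal[of l ?T a b] assms(12) r by auto
    show ?thesis
    proof (rule diagonalizing_orthogonal_matrix_signed_permutation[OF orth])
      show "?d i \<noteq> ?d j" if "i \<noteq> j" for i j
        using assms(13) that by (simp add: paired_contraction_eq)
      show "(\<Sum>a\<in>UNIV. Q $ i $ a * Q $ j $ a * ?d a) = 0" if "i \<noteq> j" for i j
      proof -
        have "0 = contraction l (transform Q ?T) [i, j]"
          using contraction_off_diagonal that inv r by simp
        \<comment> \<open>On two free indices the action is S -> Q S Q^T, where S is the contracted
          matrix of \<open>?T\<close>; by \<open>diag\<close>, S is diagonal.\<close>
        also have "\<dots> = (\<Sum>a\<in>UNIV. Q $ i $ a * (\<Sum>b\<in>UNIV. Q $ j $ b * contraction l ?T [a, b]))"
          by (simp add: contraction_transform[OF orth])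
        also have "\<dots> = (\<Sum>a\<in>UNIV. Q $ i $ a * (Q $ j $ a * ?d a))"
          by (subst diag) (simp add: if_distrib[of "\<lambda>x. _ * x"] cong: if_cong)
        finally show ?thesis by (simp add: mult.assoc)
      qed
    qed
  qed
  have iff: "invertible (Q ** A) \<and> covariance_matrix M (\<lambda>\<omega>. (Q ** A) *v Y \<omega>) = mat 1
      \<and> reflectionally_invariant r (h r (\<lambda>\<omega>. (Q ** A) *v Y \<omega>))
      \<longleftrightarrow> Q \<in> signed_permutation_matrices" for Q :: "real ^ 'n ^ 'n"
  proof -
    have inv: "invertible (Q ** A)" if "Q \<in> signed_permutation_matrices"
      using signed_permutation_matrix_orthogonal[OF that] assms(3)
      by (intro invertible_mult) (auto simp: invertible_right_inverse)
    show ?thesis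
      unfolding eps cov inv_T
      using signed_perm[of Q] inv signed_permutation_matrix_orthogonal[of Q]
        reflectionally_invariant_transform[OF _ assms(12), of Q] by argo
  qed
  \<comment> \<open>Every \<open>B\<close> is reached by taking Q = B A^{-1}, so the equivalence
    \<open>iff\<close> for the matrices \<open>Q ** A\<close> decides membership for all
    \<open>B\<close>.\<close>
  have surj: "\<exists>Q. B = Q ** A" for B :: "real ^ 'n ^ 'n"
  proof -
    obtain A' where "A' ** A = mat 1" using assms(3) unfolding invertible_def by blast
    then show ?thesis
      by (intro exI[of _ "B ** A'"]) (simp flip: matrix_mul_assoc)
  qed
  have image: "Collect P = {Q ** A | Q. Q \<in> signed_permutation_matrices}"
    if "\<And>Q. P (Q ** A) \<longleftrightarrow> Q \<in> signed_permutation_matrices" for P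
    using that surj by (metis (mono_tags, lifting))
  show ?thesis by (rule image) (rule iff)
qed

end
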